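(* For any $2\le k\le n$ and any $1<\delta\le 2$, there exists a $\delta$-balanced $(n,k,2)$-splitter of size $O\!\left(\frac{k\sqrt{k}\log n}{(\delta-1)^2}\right)$, where the implied constant is absolute.
   Context: $[n]=\{1,\dots,n\}$ and $\binom{[n]}{k}$ is the family of $k$-element subsets of $[n]$. For a family (multiset) $H$ of functions from $[n]$ to $\{1,2\}$ and $S\in\binom{[n]}{k}$, $split(S)$ is the number of $h\in H$ such that $|h^{-1}(1)\cap S|=\lceil k/2\rceil$ and $|h^{-1}(2)\cap S|=\lfloor k/2\rfloor$. For $\delta\ge1$, $H$ is a $\delta$-balanced $(n,k,2)$-splitter if there is a real $T>0$ with $T/\delta\le split(S)\le\delta T$ for all $S\in\binom{[n]}{k}$. The size of $H$ is its number of functions. *)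

theory Defs
  imports Complex_Main "HOL-Library.Multiset" "HOL-Library.FuncSet"
begin

definition k_subsets :: "nat \<Rightarrow> nat \<Rightarrow> nat set set" where
  "k_subsets n k = {S. S \<subseteq> {1..n} \<and> card S = k}"

definition splits_evenly :: "nat \<Rightarrow> (nat \<Rightarrow> nat) \<Rightarrow> nat set \<Rightarrow> bool" where
  "splits_evenly k h S \<longleftrightarrow>
     int (card (h -` {1} \<inter> S)) = \<lceil>real k / 2\<rceil> \<and>
     int (card (h -` {2} \<inter> S)) = \<lfloor>real k / 2\<rfloor>"

(* Counted with multiplicity. *)
definition split_count :: "nat \<Rightarrow> (nat \<Rightarrow> nat) multiset \<Rightarrow> nat set \<Rightarrow> nat" where
  "split_count k H S = size (filter_mset (\<lambda>h. splits_evenly k h S) H)"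

(* A function from [n] to {1,2} is an element of the extensional function space,
   so that distinct members of H differ somewhere on [n]. *)
definition balanced_splitter ::
  "real \<Rightarrow> nat \<Rightarrow> nat \<Rightarrow> (nat \<Rightarrow> nat) multiset \<Rightarrow> bool" where
  "balanced_splitter \<delta> n k H \<longleftrightarrow>
     \<delta> \<ge> 1 \<and>
     set_mset H \<subseteq> {1..n} \<rightarrow>\<^sub>E {1, 2} \<and>
     (\<exists>T::real. T > 0 \<and>
        (\<forall>S \<in> k_subsets n k.
           T / \<delta> \<le> real (split_count k H S) \<and> real (split_count k H S) \<le> \<delta> * T))"

end

(* Sample M functions uniformly and independently. A fixed k-set is split evenly by a random
   function with probability p = (k choose k div 2) / 2^k >= 1 / (2 sqrt k), so the number of
   sampled functions splitting it has mean p M, and by Chernoff's bound it leaves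
   [(1 - 2t) p M, (1 + 2t) p M] with probability at most 2 exp (- t^2 p M). With t = (delta - 1) / 4
   this interval lies in [p M / delta, delta p M], and for M of order k sqrt k ln n / (delta - 1)^2
   the failure probability is below n^(-k), so a union bound over the at most n^k sets applies.
   Probabilities are expressed by counting in the finite function space of all samples. *)
theory Submission
  imports Defs
begin

section \<open>Chernoff bounds by counting samples\<close>

text \<open>Both signs of \<open>x\<close> are needed, one for each tail. For negative
  \<open>x\<close>, combine exp(-x) >= 1 - x with (1 + x + x^2)(1 - x) = 1 - x^3 >= 1.\<close>

lemma exp_le_quadratic:
  fixes x :: real
  assumes "x \<le> 1"
  shows "exp x \<le> 1 + x + x\<^sup>2"
proof (cases "0 \<le> x")
  case True
  from exp_bound[OF this assms] show ?thesis .
next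
  case False
  have "1 \<le> (1 + x + x\<^sup>2) * (1 - x)"
  proof -
    have "(1 + x + x\<^sup>2) * (1 - x) = 1 + (- x) * x\<^sup>2"
      by (simp add: algebra_simps power2_eq_square)
    moreover have "0 \<le> (- x) * x\<^sup>2"
      using False by (intro mult_nonneg_nonneg) auto
    ultimately show ?thesis by linarith
  qed
  then have "1 / (1 - x) \<le> 1 + x + x\<^sup>2"
    using False by (simp add: divide_le_eq)
  moreover have "exp x \<le> 1 / (1 - x)"
    using exp_ge_add_one_self[of "- x"] False
    by (simp add: exp_minus field_simps)
  ultimately show ?thesis by linarith
qed

text \<open>This is the moment generating function of the hit count, scaled by the number of
  samples. The exponential factors over the coordinates, so the sum over the product space is the
  \<open>M\<close>-th power of a single sum, |F| (1 + p (e^t - 1)).\<close>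

lemma sum_exp_card_PiE_le:
  fixes F G :: "'a set" and t :: real and M :: nat
  assumes "finite F" "F \<noteq> {}" "G \<subseteq> F" "t \<le> 1"
  defines "p \<equiv> real (card G) / real (card F)"
  shows "(\<Sum>f\<in>{..<M} \<rightarrow>\<^sub>E F. exp (t * real (card {i\<in>{..<M}. f i \<in> G})))
    \<le> real (card F) ^ M * exp (p * M * (t + t\<^sup>2))"
proof -
  have F: "0 < real (card F)" using assms by (simp add: card_gt_0_iff)
  have p: "0 \<le> p" by (simp add: p_def)
  have "exp (t * real (card {i\<in>{..<M}. f i \<in> G})) = (\<Prod>i<M. if f i \<in> G then exp t else 1)" for f :: "nat \<Rightarrow> 'a"
  proof -
    have "(\<Prod>i<M. if f i \<in> G then exp t else 1) = (\<Prod>i\<in>{i\<in>{..<M}. f i \<in> G}. exp t)"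
      by (subst prod.inter_filter) auto
    then show ?thesis by (simp add: exp_of_nat_mult[symmetric] mult.commute)
  qed
  then have "(\<Sum>f\<in>{..<M} \<rightarrow>\<^sub>E F. exp (t * real (card {i\<in>{..<M}. f i \<in> G})))
      = (\<Sum>f\<in>{..<M} \<rightarrow>\<^sub>E F. \<Prod>i<M. if f i \<in> G then exp t else 1)" by simp
  also have "\<dots> = (\<Prod>i<M. \<Sum>h\<in>F. if h \<in> G then exp t else 1)"
    using assms by (intro prod_sum_PiE[symmetric]) auto
  also have "\<dots> = (\<Sum>h\<in>F. if h \<in> G then exp t else 1) ^ M" by simp
  also have "(\<Sum>h\<in>F. if h \<in> G then exp t else 1) = card F + card G * (exp t - 1)"
  proof -
    have "(\<Sum>h\<in>F. if h \<in> G then exp t else 1) = (\<Sum>h\<in>F. 1 + (if h \<in> G then exp t - 1 else 0))"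
      by (intro sum.cong) auto
    also have "\<dots> = card F + (\<Sum>h\<in>F \<inter> G. exp t - 1)"
      using assms by (simp only: sum.distrib sum.inter_restrict) simp
    also have "F \<inter> G = G" using assms by auto
    finally show ?thesis by simp
  qed
  also have "(card F + card G * (exp t - 1)) ^ M \<le> (card F * exp (p * (t + t\<^sup>2))) ^ M"
  proof (rule power_mono)
    have "card F + card G * (exp t - 1) = card F * (1 + p * (exp t - 1))"
      using F by (simp add: p_def field_simps)
    also have "\<dots> \<le> card F * (1 + p * (t + t\<^sup>2))"
      using exp_le_quadratic[OF \<open>t \<le> 1\<close>] p by (intro mult_left_mono add_left_mono) auto
    also have "\<dots> \<le> card F * exp (p * (t + t\<^sup>2))"
      by (intro mult_left_mono exp_ge_add_one_self) auto
    finally show "card F + card G * (exp t - 1) \<le> card F * exp (p * (t + t\<^sup>2))" .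
    have "real (card G) \<le> card F" using assms by (simp add: card_mono)
    moreover have "0 \<le> card G * exp t" by simp
    ultimately show "0 \<le> card F + card G * (exp t - 1)" unfolding right_diff_distrib by linarith
  qed
  also have "\<dots> = real (card F) ^ M * exp (p * M * (t + t\<^sup>2))"
    by (simp add: power_mult_distrib exp_of_nat_mult[symmetric] mult_ac)
  finally show ?thesis .
qed

text \<open>The sign of \<open>t\<close> selects the upper or the lower tail.\<close>
lemma card_chernoff_tail:
  fixes F G :: "'a set" and t :: real and M :: nat
  assumes "finite F" "F \<noteq> {}" "G \<subseteq> F" "t \<le> 1"
  defines "p \<equiv> real (card G) / real (card F)"
  shows "real (card {f \<in> {..<M} \<rightarrow>\<^sub>E F.
      t * (p * M) + 2 * t\<^sup>2 * (p * M) \<le> t * real (card {i\<in>{..<M}. f i \<in> G})})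
    \<le> real (card F) ^ M * exp (- (t\<^sup>2 * (p * M)))" (is "real (card ?B) \<le> _")
proof -
  let ?P = "{..<M} \<rightarrow>\<^sub>E F"
  let ?X = "\<lambda>f. real (card {i\<in>{..<M}. f i \<in> G})"
  let ?a = "t * (p * M) + 2 * t\<^sup>2 * (p * M)"
  have fin: "finite ?P" using assms by (intro finite_PiE) auto
  \<comment> \<open>Markov's inequality: every sample in \<open>?B\<close> contributes at least
    \<open>exp ?a\<close> to the exponential sum.\<close>
  have "real (card ?B) * exp ?a = (\<Sum>f\<in>?B. exp ?a)" by simp
  also have "\<dots> \<le> (\<Sum>f\<in>?B. exp (t * ?X f))" by (intro sum_mono) auto
  also have "\<dots> \<le> (\<Sum>f\<in>?P. exp (t * ?X f))"
    using fin by (intro sum_mono2) auto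
  also have "\<dots> \<le> real (card F) ^ M * exp (p * M * (t + t\<^sup>2))"
    unfolding p_def by (rule sum_exp_card_PiE_le) fact+
  \<comment> \<open>The threshold allows twice the quadratic term of the moment bound; the surplus
    is the decay that remains once \<open>exp ?a\<close> is cancelled.\<close>
  also have "p * M * (t + t\<^sup>2) = - (t\<^sup>2 * (p * M)) + ?a" by (simp add: algebra_simps)
  finally show ?thesis by (simp only: exp_add mult.assoc[symmetric] mult_le_cancel_right_pos exp_gt_zero)
qed

text \<open>A union bound over \<open>I\<close> and both tails leaves fewer bad samples than there
  are samples. The common size \<open>g\<close> gives all the sets the same mean, so that one value
  can later serve as T.\<close>

lemma exists_concentrated_sample:
  fixes F :: "'a set" and G :: "'b \<Rightarrow> 'a set" and t :: real and M g :: nat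
  assumes "finite F" "F \<noteq> {}" "finite I" "\<And>S. S \<in> I \<Longrightarrow> G S \<subseteq> F" "\<And>S. S \<in> I \<Longrightarrow> card (G S) = g"
    and "0 < t" "t \<le> 1"
  defines "\<mu> \<equiv> real g / real (card F) * M"
  assumes small: "2 * real (card I) * exp (- (t\<^sup>2 * \<mu>)) < 1"
  obtains f where "f \<in> {..<M} \<rightarrow>\<^sub>E F"
    "\<And>S. S \<in> I \<Longrightarrow> \<bar>real (card {i\<in>{..<M}. f i \<in> G S}) - \<mu>\<bar> < 2 * t * \<mu>"
proof -
  let ?P = "{..<M} \<rightarrow>\<^sub>E F"
  let ?X = "\<lambda>S f. real (card {i\<in>{..<M}. f i \<in> G S})"
  \<comment> \<open>\<open>B t S\<close> collects the samples that are too high on \<open>S\<close>,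
    and \<open>B (- t) S\<close> those that are too low.\<close>
  define B where "B s S = {f \<in> ?P. s * \<mu> + 2 * s\<^sup>2 * \<mu> \<le> s * ?X S f}" for s S
  have F: "0 < real (card F)" using assms by (simp add: card_gt_0_iff)
  have fin: "finite ?P" using assms by (intro finite_PiE) auto
  have tail: "real (card (B s S)) \<le> real (card F) ^ M * exp (- (s\<^sup>2 * \<mu>))"
    if "S \<in> I" "s \<le> 1" for s S
    using card_chernoff_tail[OF assms(1,2) assms(4)[OF that(1)] that(2), of M] assms(5)[OF that(1)]
    unfolding B_def \<mu>_def by simp
  have "real (card (\<Union>S\<in>I. B t S \<union> B (- t) S)) \<le> (\<Sum>S\<in>I. real (card (B t S \<union> B (- t) S)))"
    using card_UN_le[OF \<open>finite I\<close>, of "\<lambda>S. B t S \<union> B (- t) S"] by (simp flip: of_nat_sum)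
  also have "\<dots> \<le> (\<Sum>S\<in>I. 2 * (real (card F) ^ M * exp (- (t\<^sup>2 * \<mu>))))"
  proof (rule sum_mono)
    fix S assume "S \<in> I"
    have "real (card (B t S \<union> B (- t) S)) \<le> real (card (B t S)) + real (card (B (- t) S))"
      using card_Un_le[of "B t S" "B (- t) S"] by (simp flip: of_nat_add)
    then show "real (card (B t S \<union> B (- t) S)) \<le> 2 * (real (card F) ^ M * exp (- (t\<^sup>2 * \<mu>)))"
      using tail[OF \<open>S \<in> I\<close>, of t] tail[OF \<open>S \<in> I\<close>, of "- t"] assms(6,7) by simp
  qed
  also have "\<dots> = real (card F) ^ M * (2 * real (card I) * exp (- (t\<^sup>2 * \<mu>)))" by simp
  also have "\<dots> < real (card F) ^ M * 1"
    using small F by (intro mult_strict_left_mono) auto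
  also have "\<dots> = real (card ?P)" by (simp add: card_PiE)
  finally have "?P \<noteq> (\<Union>S\<in>I. B t S \<union> B (- t) S)" by auto
  moreover have "(\<Union>S\<in>I. B t S \<union> B (- t) S) \<subseteq> ?P" unfolding B_def by auto
  ultimately obtain f where f: "f \<in> ?P" "\<And>S. S \<in> I \<Longrightarrow> f \<notin> B t S \<and> f \<notin> B (- t) S" by blast
  have "\<bar>?X S f - \<mu>\<bar> < 2 * t * \<mu>" if "S \<in> I" for S
  proof -
    have "t * ?X S f < t * (\<mu> + 2 * t * \<mu>)" "t * (\<mu> - 2 * t * \<mu>) < t * ?X S f"
      using f(1) f(2)[OF that] unfolding B_def by (auto simp: algebra_simps power2_eq_square)
    then show ?thesis using \<open>0 < t\<close> by (simp add: abs_less_iff)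
  qed
  with f(1) show ?thesis by (rule that)
qed

section \<open>Counting the functions that split a set evenly\<close>

text \<open>The parts of \<open>B\<close> inside and outside \<open>S\<close> are chosen
  independently, the outer one arbitrarily.\<close>

lemma card_subsets_inter_card:
  assumes "finite A" "S \<subseteq> A"
  shows "card {B. B \<subseteq> A \<and> card (B \<inter> S) = r} = (card S choose r) * 2 ^ (card A - card S)"
proof -
  have "bij_betw (\<lambda>B. (B \<inter> S, B - S)) {B. B \<subseteq> A \<and> card (B \<inter> S) = r}
      ({B. B \<subseteq> S \<and> card B = r} \<times> Pow (A - S))"
  proof (rule bij_betw_byWitness[where f' = "\<lambda>(C, D). C \<union> D"])
    show "(\<lambda>(C, D). C \<union> D) ` ({B. B \<subseteq> S \<and> card B = r} \<times> Pow (A - S))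
        \<subseteq> {B. B \<subseteq> A \<and> card (B \<inter> S) = r}"
    proof clarsimp
      fix C D assume *: "C \<subseteq> S" "D \<subseteq> A - S" "r = card C"
      then have "(C \<union> D) \<inter> S = C" by auto
      with * assms(2) show "C \<subseteq> A \<and> D \<subseteq> A \<and> card ((C \<union> D) \<inter> S) = card C" by auto
    qed
  qed auto
  moreover have "finite S" using assms finite_subset by auto
  ultimately show ?thesis
    using assms by (simp add: bij_betw_same_card card_cartesian_product n_subsets card_Pow card_Diff_subset)
qed

text \<open>A function into {1, 2} is determined by its preimage of 2, which turns the count into
  one of subsets. The result depends on \<open>S\<close> only through \<open>k\<close>.\<close>

lemma card_splits_evenly:
  assumes "S \<in> k_subsets n k"
  shows "card {h \<in> {1..n} \<rightarrow>\<^sub>E {1, 2}. splits_evenly k h S} = (k choose (k div 2)) * 2 ^ (n - k)"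
proof -
  have S: "S \<subseteq> {1..n}" "card S = k" "finite S"
    using assms finite_subset[of S "{1..n}"] unfolding k_subsets_def by auto
  have fl: "\<lfloor>real k / 2\<rfloor> = int (k div 2)" "\<lceil>real k / 2\<rceil> = int (k - k div 2)"
    by linarith+
  \<comment> \<open>The two preimages partition \<open>S\<close>, so the count for 2 fixes the count
    for 1.\<close>
  have eq: "splits_evenly k h S \<longleftrightarrow> card ({i\<in>{1..n}. h i = 2} \<inter> S) = k div 2"
    if "h \<in> {1..n} \<rightarrow>\<^sub>E {1, 2}" for h
  proof -
    have "S = (h -` {1} \<inter> S) \<union> (h -` {2} \<inter> S)"
      using that S(1) by (auto simp: PiE_iff)
    moreover have "card ((h -` {1} \<inter> S) \<union> (h -` {2} \<inter> S)) = card (h -` {1} \<inter> S) + card (h -` {2} \<inter> S)"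
      using S(3) by (intro card_Un_disjoint) auto
    moreover have "{i\<in>{1..n}. h i = 2} \<inter> S = h -` {2} \<inter> S" using S(1) by auto
    ultimately show ?thesis
      using S(2) unfolding splits_evenly_def fl by auto
  qed
  have "bij_betw (\<lambda>h. {i\<in>{1..n}. h i = 2}) {h \<in> {1..n} \<rightarrow>\<^sub>E {1, 2}. splits_evenly k h S}
      {B. B \<subseteq> {1..n} \<and> card (B \<inter> S) = k div 2}"
  \<comment> \<open>The restricted abstraction makes the inverse \<open>undefined\<close> outside
    [n], as membership in the extensional space demands.\<close>
  proof (rule bij_betw_byWitness[where f' = "\<lambda>B. \<lambda>i\<in>{1..n}. if i \<in> B then 2 else 1"])
    show "\<forall>h\<in>{h \<in> {1..n} \<rightarrow>\<^sub>E {1, 2}. splits_evenly k h S}.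
        (\<lambda>i\<in>{1..n}. if i \<in> {i \<in> {1..n}. h i = 2} then 2 else 1) = h"
      by (fastforce simp: fun_eq_iff PiE_iff extensional_def)
    show inv: "\<forall>B\<in>{B. B \<subseteq> {1..n} \<and> card (B \<inter> S) = k div 2}.
        {i \<in> {1..n}. (\<lambda>i\<in>{1..n}. if i \<in> B then 2 else 1) i = (2::nat)} = B"
      by auto
    show "(\<lambda>B. \<lambda>i\<in>{1..n}. if i \<in> B then 2 else 1) ` {B. B \<subseteq> {1..n} \<and> card (B \<inter> S) = k div 2}
        \<subseteq> {h \<in> {1..n} \<rightarrow>\<^sub>E {1, 2}. splits_evenly k h S}"
    proof (rule image_subsetI)
      fix B assume B: "B \<in> {B. B \<subseteq> {1..n} \<and> card (B \<inter> S) = k div 2}"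
      let ?h = "\<lambda>i\<in>{1..n}. if i \<in> B then 2 else (1::nat)"
      have "?h \<in> {1..n} \<rightarrow>\<^sub>E {1, 2}" by (auto simp: PiE_iff)
      moreover from this have "splits_evenly k ?h S"
        using eq[of ?h] inv[rule_format, OF B] B by (simp only: mem_Collect_eq)
      ultimately show "?h \<in> {h \<in> {1..n} \<rightarrow>\<^sub>E {1, 2}. splits_evenly k h S}" by simp
    qed
  qed (use eq in auto)
  then show ?thesis
    using card_subsets_inter_card[of "{1..n}" S "k div 2"] S by (simp add: bij_betw_same_card)
qed

section \<open>Lower bounds for the middle binomial coefficient\<close>

text \<open>The squared form has no root and goes by induction, using the ratio 2(2m + 1)/(m + 1) of
  consecutive central coefficients.\<close>

lemma central_binomial_sqrt_lower_bound:
  assumes "0 < m"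
  shows "4 ^ m \<le> 2 * sqrt (real m) * real ((2 * m) choose m)"
proof -
  have "(16::real) ^ m \<le> 4 * m * real ((2 * m) choose m) ^ 2"
    using assms
  proof (induction m rule: nat_induct_non_zero)
    case (Suc m)
    have rec: "(real m + 1) * real ((2 * Suc m) choose Suc m) = 2 * (2 * m + 1) * real ((2 * m) choose m)"
    proof -
      have "Suc m * ((2 * Suc m) choose Suc m) = (2 * Suc m) * (Suc (2 * m) choose m)"
        using Suc_times_binomial_eq[of "Suc (2 * m)" m] by (simp add: mult_ac)
      moreover have "Suc m * (Suc (2 * m) choose m) = Suc (2 * m) * ((2 * m) choose m)"
        using Suc_times_binomial_eq[of "2 * m" m] binomial_symmetric[of m "Suc (2 * m)"]
        by (simp add: mult_ac Suc_diff_le)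
      ultimately have "Suc m * ((2 * Suc m) choose Suc m) = 2 * (Suc (2 * m) * ((2 * m) choose m))"
        by (metis mult.assoc mult.left_commute)
      then have "real (Suc m * ((2 * Suc m) choose Suc m)) = real (2 * (Suc (2 * m) * ((2 * m) choose m)))"
        by (rule arg_cong)
      then show ?thesis by (simp add: algebra_simps)
    qed
    let ?c = "real ((2 * m) choose m)" and ?d = "real ((2 * Suc m) choose Suc m)"
    have "(16::real) ^ Suc m * (m + 1) \<le> 16 * (4 * m * ?c\<^sup>2) * (m + 1)"
      using Suc.IH by (intro mult_right_mono) auto
    \<comment> \<open>This amounts to 4m(m + 1) <= (2m + 1)^2.\<close>
    also have "\<dots> \<le> 4 * (2 * (2 * m + 1) * ?c)\<^sup>2"
      by (simp add: power2_eq_square algebra_simps)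
    also have "\<dots> = 4 * ((real m + 1) * ?d)\<^sup>2" using rec by simp
    also have "\<dots> = (4 * Suc m * ?d\<^sup>2) * (m + 1)"
      by (simp add: power2_eq_square algebra_simps)
    finally show ?case by (rule mult_right_le_imp_le) simp
  qed simp
  moreover have "((4::real) ^ m)\<^sup>2 = 16 ^ m"
    by (simp add: power2_eq_square flip: power_mult_distrib)
  ultimately have "((4::real) ^ m)\<^sup>2 \<le> (2 * sqrt (real m) * real ((2 * m) choose m))\<^sup>2"
    by (simp add: power_mult_distrib)
  then show ?thesis by (rule power2_le_imp_le) simp
qed

text \<open>For odd k = 2m + 1, the central coefficient of 2(m + 1) is twice
  \<open>k choose m\<close>, and m + 1 <= k.\<close>

lemma middle_binomial_lower_bound:
  assumes "0 < k"
  shows "2 ^ k \<le> 2 * sqrt (real k) * real (k choose (k div 2))"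
proof (cases "even k")
  case True
  then obtain m where m: "k = 2 * m" by blast
  have "2 ^ k = (4::real) ^ m" by (simp add: m power_mult)
  also have "\<dots> \<le> 2 * sqrt (real m) * real (k choose (k div 2))"
    using central_binomial_sqrt_lower_bound[of m] assms m by simp
  also have "\<dots> \<le> 2 * sqrt (real k) * real (k choose (k div 2))"
    by (intro mult_right_mono) (auto simp: m)
  finally show ?thesis .
next
  case False
  then obtain m where m: "k = 2 * m + 1" by (elim oddE)
  have "(2 * Suc m) choose Suc m = 2 * (k choose m)"
    using binomial_symmetric[of m k] by (simp add: m Suc_diff_le)
  then have "2 * 2 ^ k \<le> 2 * (2 * sqrt (real (Suc m)) * real (k choose m))"
    using central_binomial_sqrt_lower_bound[of "Suc m"] by (simp add: m power_mult)
  then have "2 ^ k \<le> 2 * sqrt (real (Suc m)) * real (k choose m)" by (simp add: mult_ac)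
  also have "\<dots> \<le> 2 * sqrt (real k) * real (k choose m)"
    by (intro mult_right_mono) (auto simp: m)
  finally show ?thesis by (simp add: m)
qed

section \<open>From samples to splitters, and the choice of the sample size\<close>

lemma split_count_image_mset:
  assumes "finite A"
  shows "split_count k (image_mset f (mset_set A)) S = card {i \<in> A. splits_evenly k (f i) S}"
  using assms by (simp add: split_count_def filter_mset_image_mset)

lemma exists_balanced_splitter:
  fixes n k M :: nat and \<delta> :: real
  assumes k: "2 \<le> k" "k \<le> n" and \<delta>: "1 < \<delta>" "\<delta> \<le> 2"
    and M: "64 * (real k * sqrt (real k) * ln (real n) / (\<delta> - 1)\<^sup>2) \<le> M"
  shows "\<exists>H. balanced_splitter \<delta> n k H \<and> size H = M"
proof -
  let ?F = "{1..n} \<rightarrow>\<^sub>E {1, 2 :: nat}"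
  define g where "g = (k choose (k div 2)) * 2 ^ (n - k)"
  define t where "t = (\<delta> - 1) / 4"
  define \<mu> where "\<mu> = real g / real (card ?F) * M"
  have t: "0 < t" "t \<le> 1" using \<delta> by (auto simp: t_def)
  have ln2: "0 < ln (real n)" "ln 2 \<le> ln (real n)" using k by auto
  have finI: "finite (k_subsets n k)" unfolding k_subsets_def by simp
  have cardF: "card ?F = 2 ^ n" by (simp add: card_PiE numeral_2_eq_2)
  have p: "1 / (2 * sqrt (real k)) \<le> real g / real (card ?F)"
  proof -
    have "real g / real (card ?F) = real (k choose (k div 2)) / 2 ^ k"
      unfolding cardF using k(2) by (simp add: g_def power_diff_power_eq field_simps flip: power_add)
    moreover have "1 / (2 * sqrt (real k)) \<le> real (k choose (k div 2)) / 2 ^ k"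
      using middle_binomial_lower_bound[of k] k by (simp add: field_simps)
    ultimately show ?thesis by (simp only:)
  qed
  \<comment> \<open>The factors 1/16 from the square of \<open>t\<close> and 1/2 from the bound on p
    reduce the constant 64 to 2. One k ln n then pays for the at most n^k sets; the other must beat
    the factor 2 for the two tails.\<close>
  have t2\<mu>: "2 * (k * ln n) \<le> t\<^sup>2 * \<mu>"
  proof -
    have "2 * (k * ln n) = t\<^sup>2 * (1 / (2 * sqrt k) * (64 * (real k * sqrt (real k) * ln (real n) / (\<delta> - 1)\<^sup>2)))"
      using k \<delta> by (simp add: t_def power_divide)
    also have "\<dots> \<le> t\<^sup>2 * (real g / real (card ?F) * M)"
      using p M ln2 by (intro mult_left_mono mult_mono) auto
    finally show ?thesis by (simp add: \<mu>_def)
  qed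
  have \<mu>: "0 < \<mu>"
  proof -
    have "0 < 2 * (k * ln n)" using k ln2 by simp
    with t2\<mu> have "0 < t\<^sup>2 * \<mu>" by linarith
    then show ?thesis by (simp add: zero_less_mult_iff)
  qed
  have small: "2 * real (card (k_subsets n k)) * exp (- (t\<^sup>2 * \<mu>)) < 1"
  proof -
    have "card (k_subsets n k) = n choose k"
      unfolding k_subsets_def using n_subsets[of "{1..n}" k] by simp
    also have "real (n choose k) \<le> real (n ^ k)"
      using binomial_le_pow[OF k(2)] of_nat_le_iff by blast
    also have "\<dots> = exp (k * ln n)" using k by (simp add: exp_of_nat_mult)
    finally have "real (card (k_subsets n k)) \<le> exp (k * ln n)" by simp
    then have "2 * real (card (k_subsets n k)) * exp (- (t\<^sup>2 * \<mu>))
        \<le> exp (ln 2) * exp (k * ln n) * exp (- (2 * (k * ln n)))"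
      using t2\<mu> by (intro mult_mono) auto
    also have "\<dots> = exp (ln 2 - k * ln n)" by (simp only: exp_add[symmetric]) simp
    also have "ln 2 < k * ln n"
    proof -
      have "ln 2 < 2 * ln n" using ln2 by linarith
      also have "\<dots> \<le> k * ln n" using k ln2 by (intro mult_right_mono) auto
      finally show ?thesis .
    qed
    then have "exp (ln 2 - k * ln n) < 1" by simp
    finally show ?thesis .
  qed
  obtain f where f: "f \<in> {..<M} \<rightarrow>\<^sub>E ?F"
    "\<And>S. S \<in> k_subsets n k \<Longrightarrow>
      \<bar>real (card {i\<in>{..<M}. f i \<in> {h \<in> ?F. splits_evenly k h S}}) - \<mu>\<bar> < 2 * t * \<mu>"
  proof (rule exists_concentrated_sample[where F = ?F and I = "k_subsets n k" and t = t and M = M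
        and g = g and G = "\<lambda>S. {h \<in> ?F. splits_evenly k h S}"])
    show "finite ?F" by (intro finite_PiE) auto
    show "?F \<noteq> {}" by (simp add: PiE_eq_empty_iff)
    show "2 * real (card (k_subsets n k)) * exp (- (t\<^sup>2 * (real g / real (card ?F) * M))) < 1"
      using small by (simp add: \<mu>_def)
    show "card {h \<in> ?F. splits_evenly k h S} = g" if "S \<in> k_subsets n k" for S
      using card_splits_evenly[OF that] by (simp only: g_def)
  qed (use finI t \<mu>_def in auto)
  \<comment> \<open>Repeated sample values keep their multiplicity, so the size is exactly
    \<open>M\<close>.\<close>
  define H where "H = image_mset f (mset_set {..<M})"
  have "\<mu> / \<delta> \<le> real (split_count k H S) \<and> real (split_count k H S) \<le> \<delta> * \<mu>"
    if S: "S \<in> k_subsets n k" for S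
  proof -
    have "{i\<in>{..<M}. f i \<in> {h \<in> ?F. splits_evenly k h S}} = {i\<in>{..<M}. splits_evenly k (f i) S}"
      using f(1) by (auto simp: PiE_iff)
    then have *: "\<bar>real (split_count k H S) - \<mu>\<bar> < 2 * t * \<mu>"
      using f(2)[OF S] by (simp add: H_def split_count_image_mset)
    \<comment> \<open>Since 1 - 2t = (3 - \<delta>)/2, clearing denominators gives (\<delta> - 1)(2
      - \<delta>) >= 0, which is where \<delta> \<le> 2 enters.\<close>
    have "1 / \<delta> \<le> 1 - 2 * t"
    proof -
      have "0 \<le> (\<delta> - 1) * (2 - \<delta>)" using \<delta> by simp
      then show ?thesis using \<delta> by (simp add: t_def field_simps)
    qed
    then have "1 / \<delta> * \<mu> \<le> (1 - 2 * t) * \<mu>" using \<mu> by (intro mult_right_mono) auto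
    moreover have "(1 + 2 * t) * \<mu> \<le> \<delta> * \<mu>"
      using \<mu> \<delta> by (intro mult_right_mono) (auto simp: t_def field_simps)
    ultimately show ?thesis using * by (auto simp: algebra_simps abs_less_iff)
  qed
  moreover have "set_mset H \<subseteq> ?F" using f(1) by (auto simp: H_def)
  ultimately have "balanced_splitter \<delta> n k H"
    unfolding balanced_splitter_def using \<mu> \<delta> by auto
  moreover have "size H = M" by (simp add: H_def)
  ultimately show ?thesis by blast
qed

theorem theorem3:
  "\<exists>C::real. C > 0 \<and>
     (\<forall>(n::nat) (k::nat) (\<delta>::real).
        2 \<le> k \<and> k \<le> n \<and> 1 < \<delta> \<and> \<delta> \<le> 2 \<longrightarrow>
        (\<exists>H. balanced_splitter \<delta> n k H \<and>
             real (size H) \<le> C * (real k * sqrt (real k) * ln (real n) / (\<delta> - 1)\<^sup>2)))"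
proof (intro exI[of _ 65] conjI allI impI)
  fix n k :: nat and \<delta> :: real
  assume a: "2 \<le> k \<and> k \<le> n \<and> 1 < \<delta> \<and> \<delta> \<le> 2"
  define b where "b = real k * sqrt (real k) * ln (real n) / (\<delta> - 1)\<^sup>2"
  \<comment> \<open>Rounding 64 b up to an integer costs at most 1, which this bound absorbs into
    the constant 65.\<close>
  have "1 \<le> b"
  proof -
    have "1 / 2 \<le> ln (real n)"
    proof -
      \<comment> \<open>From ln(1/2) <= 1/2 - 1.\<close>
      have "1 / 2 \<le> ln (2::real)" using ln_le_minus_one[of "1 / 2 :: real"] by (simp add: ln_div)
      also have "\<dots> \<le> ln (real n)" using a by simp
      finally show ?thesis .
    qed
    then have "2 * 1 * (1 / 2) \<le> real k * sqrt (real k) * ln (real n)"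
      using a by (intro mult_mono) auto
    moreover have "(\<delta> - 1)\<^sup>2 \<le> 1" "0 < (\<delta> - 1)\<^sup>2" using a by (auto simp: power_le_one)
    ultimately show ?thesis by (simp add: b_def le_divide_eq)
  qed
  obtain H where H: "balanced_splitter \<delta> n k H" "size H = nat \<lceil>64 * b\<rceil>"
    using exists_balanced_splitter[of k n \<delta> "nat \<lceil>64 * b\<rceil>"] a real_nat_ceiling_ge unfolding b_def by blast
  have "real (size H) \<le> 64 * b + 1"
    using H(2) \<open>1 \<le> b\<close> by linarith
  with \<open>1 \<le> b\<close> have "real (size H) \<le> 65 * b" by linarith
  with H(1) show "\<exists>H. balanced_splitter \<delta> n k H \<and> real (size H) \<le>
      65 * (real k * sqrt (real k) * ln (real n) / (\<delta> - 1)\<^sup>2)"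
    unfolding b_def by blast
qed simp

end
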